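(* Let $\{\mathbf{M}_i\}_{i=1}^N$ be a collection of $N$ time-dependent real symmetric $2\times 2$ matrices, written in spectral coordinates as $$\mathbf{M}_i=\mathbf{R}(\theta_i)\begin{bmatrix}\lambda_i^1&0\\0&\lambda_i^2\end{bmatrix}\mathbf{R}(-\theta_i),\qquad \mathbf{R}(\theta)=\begin{bmatrix}\cos\theta&\sin\theta\\-\sin\theta&\cos\theta\end{bmatrix},$$ where $\lambda_i^1,\lambda_i^2$ (the two eigenvalues of $\mathbf{M}_i$) and $\theta_i$ (the angle of rotation of its orthogonal eigenframe from the standard axes) are differentiable real-valued functions of time $t$. Then the $N$ matrix equations $$\frac{d\mathbf{M}_i}{dt}=\sum_{j=1}^N[\mathbf{M}_j,[\mathbf{M}_i,\mathbf{M}_j]],\qquad i=1,\dots,N,$$ are equivalent to the following evolution equations on the $2N$ eigenvalues $\lambda_i^1,\lambda_i^2$ and the $N$ eigenangles $\theta_i$, for $i=1,\dots,N$: $$\dot{\lambda}_i^1+\dot{\lambda}_i^2=0,$$ $$\dot{\lambda}_i^2-\dot{\lambda}_i^1=-(\lambda_i^2-\lambda_i^1)\sum_{j=1}^N(\lambda_j^2-\lambda_j^1)^2\sin^2(2(\theta_j-\theta_i)),$$ $$\dot{\theta}_i=\sum_{j=1}^N\frac14(\lambda_j^2-\lambda_j^1)^2\sin(4(\theta_j-\theta_i)).$$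
   Context: $[\mathbf{A},\mathbf{B}]=\mathbf{A}\mathbf{B}-\mathbf{B}\mathbf{A}$ denotes the matrix commutator and a dot denotes $d/dt$.
   Formalization: The equivalence is proved with the angle equation for θ_i required only at times when λ_i^1 ≠ λ_i^2 (in full if the eigenvalues are always distinct); the scalar equations always imply the matrix ones. If λ_i^1 = λ_i^2, θ_i is arbitrary and the literal claim fails. *)

theory Defs
  imports "HOL-Analysis.Analysis"
begin

definition commutator :: "real^'n^'n \<Rightarrow> real^'n^'n \<Rightarrow> real^'n^'n" where
  "commutator A B = A ** B - B ** A"

definition rotation :: "real \<Rightarrow> real^2^2" where
  "rotation \<theta> = vector [vector [cos \<theta>, sin \<theta>], vector [- sin \<theta>, cos \<theta>]]"

definition diag2 :: "real \<Rightarrow> real \<Rightarrow> real^2^2" where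
  "diag2 a b = vector [vector [a, 0], vector [0, b]]"

definition spectral_matrix :: "real \<Rightarrow> real \<Rightarrow> real \<Rightarrow> real^2^2" where
  "spectral_matrix a b \<theta> = rotation \<theta> ** diag2 a b ** rotation (- \<theta>)"

text \<open>
  Derivatives are taken within the time domain \<open>T\<close>, so that they are one-sided at an endpoint
  belonging to \<open>T\<close>. The definitions of the scalar equations are meant for functions that are
  differentiable on \<open>T\<close>; otherwise \<^const>\<open>vector_derivative\<close> is unspecified.
\<close>

definition matrix_flow :: "nat \<Rightarrow> real set \<Rightarrow> (nat \<Rightarrow> real \<Rightarrow> real^2^2) \<Rightarrow> bool" where
  "matrix_flow N T M \<longleftrightarrow>
    (\<forall>i\<in>{1..N}. \<forall>t\<in>T.
      (M i has_vector_derivative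
        (\<Sum>j=1..N. commutator (M j t) (commutator (M i t) (M j t)))) (at t within T))"

definition trace_eqn ::
    "real set \<Rightarrow> (nat \<Rightarrow> real \<Rightarrow> real) \<Rightarrow> (nat \<Rightarrow> real \<Rightarrow> real) \<Rightarrow> nat \<Rightarrow> real \<Rightarrow> bool" where
  "trace_eqn T l1 l2 i t \<longleftrightarrow>
    vector_derivative (l1 i) (at t within T) + vector_derivative (l2 i) (at t within T) = 0"

definition gap_eqn ::
    "nat \<Rightarrow> real set \<Rightarrow> (nat \<Rightarrow> real \<Rightarrow> real) \<Rightarrow> (nat \<Rightarrow> real \<Rightarrow> real) \<Rightarrow> (nat \<Rightarrow> real \<Rightarrow> real)
      \<Rightarrow> nat \<Rightarrow> real \<Rightarrow> bool" where
  "gap_eqn N T l1 l2 \<theta> i t \<longleftrightarrow>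
    vector_derivative (l2 i) (at t within T) - vector_derivative (l1 i) (at t within T) =
      - (l2 i t - l1 i t) * (\<Sum>j=1..N. (l2 j t - l1 j t)^2 * (sin (2 * (\<theta> j t - \<theta> i t)))^2)"

definition angle_eqn ::
    "nat \<Rightarrow> real set \<Rightarrow> (nat \<Rightarrow> real \<Rightarrow> real) \<Rightarrow> (nat \<Rightarrow> real \<Rightarrow> real) \<Rightarrow> (nat \<Rightarrow> real \<Rightarrow> real)
      \<Rightarrow> nat \<Rightarrow> real \<Rightarrow> bool" where
  "angle_eqn N T l1 l2 \<theta> i t \<longleftrightarrow>
    vector_derivative (\<theta> i) (at t within T) =
      (\<Sum>j=1..N. 1/4 * (l2 j t - l1 j t)^2 * sin (4 * (\<theta> j t - \<theta> i t)))"

definition spectral_flow ::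
    "nat \<Rightarrow> real set \<Rightarrow> (nat \<Rightarrow> real \<Rightarrow> real) \<Rightarrow> (nat \<Rightarrow> real \<Rightarrow> real) \<Rightarrow> (nat \<Rightarrow> real \<Rightarrow> real)
      \<Rightarrow> bool" where
  "spectral_flow N T l1 l2 \<theta> \<longleftrightarrow>
    (\<forall>i\<in>{1..N}. \<forall>t\<in>T.
      trace_eqn T l1 l2 i t \<and> gap_eqn N T l1 l2 \<theta> i t \<and> angle_eqn N T l1 l2 \<theta> i t)"

text \<open>
  If \<open>l1 i t = l2 i t\<close> then the \<open>i\<close>-th matrix is scalar at time \<open>t\<close>: it has no
  distinguished eigenframe, and its evolution does not constrain \<open>\<theta> i\<close>. (With one matrix,
  constantly the identity, and \<open>\<theta> 1 t = t\<close>, the matrix equation holds while the angle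
  equation fails.) The following system asks for the angle equation only where the eigenframe
  is determined.
\<close>

definition spectral_flow_where_distinct ::
    "nat \<Rightarrow> real set \<Rightarrow> (nat \<Rightarrow> real \<Rightarrow> real) \<Rightarrow> (nat \<Rightarrow> real \<Rightarrow> real) \<Rightarrow> (nat \<Rightarrow> real \<Rightarrow> real)
      \<Rightarrow> bool" where
  "spectral_flow_where_distinct N T l1 l2 \<theta> \<longleftrightarrow>
    (\<forall>i\<in>{1..N}. \<forall>t\<in>T.
      trace_eqn T l1 l2 i t \<and> gap_eqn N T l1 l2 \<theta> i t \<and>
      (l1 i t \<noteq> l2 i t \<longrightarrow> angle_eqn N T l1 l2 \<theta> i t))"

end

theory Submission
  imports Defs
begin

text \<open>
  Conjugation by \<open>R(\<theta>)\<close> is a linear automorphism of the matrix algebra, so it commutes with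
  commutators and is injective. Hence both sides of the matrix equation for \<open>M\<^sub>i\<close> can be read in the
  eigenframe of \<open>M\<^sub>i\<close>, where they become explicit symmetric matrices.

  On the left, the rotating frame contributes an off-diagonal term: in the eigenframe,
  \<open>dM\<^sub>i/dt\<close> has diagonal entries \<open>d\<lambda>\<^sub>i\<^sup>1/dt\<close>, \<open>d\<lambda>\<^sub>i\<^sup>2/dt\<close> and off-diagonal entry
  \<open>(\<lambda>\<^sub>i\<^sup>2 - \<lambda>\<^sub>i\<^sup>1) d\<theta>\<^sub>i/dt\<close> (lemma \<open>has_vector_derivative_spectral_matrix\<close>). On the right, \<open>M\<^sub>i\<close> is
  diagonal and \<open>M\<^sub>j\<close> has the eigenangle \<open>\<theta>\<^sub>j - \<theta>\<^sub>i\<close>, so the double commutator is a trace-free symmetric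
  matrix given by double-angle formulas (lemma \<open>double_commutator_spectral_matrix\<close>). Comparing the three
  independent entries gives the trace and gap equations from the diagonal, and the angle equation
  multiplied by \<open>\<lambda>\<^sub>i\<^sup>2 - \<lambda>\<^sub>i\<^sup>1\<close> from the off-diagonal; this factor is why the angle equation
  follows only where the eigenvalues differ.
\<close>

definition symmetric2 :: "real \<Rightarrow> real \<Rightarrow> real \<Rightarrow> real^2^2" where
  "symmetric2 a c b = vector [vector [a, c], vector [c, b]]"

definition frame :: "real \<Rightarrow> real^2^2 \<Rightarrow> real^2^2" where
  "frame \<theta> A = rotation \<theta> ** A ** rotation (- \<theta>)"

lemmas matrix2_simps = vec_eq_iff forall_2 sum_2 matrix_matrix_mult_def

lemma rotation_add: "rotation \<alpha> ** rotation \<beta> = rotation (\<alpha> + \<beta>)"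
  by (simp add: rotation_def matrix2_simps sin_add cos_add algebra_simps)

lemma rotation_0: "rotation 0 = mat 1"
  by (simp add: rotation_def matrix2_simps mat_def)

lemma frame_add_angle: "frame \<alpha> (frame \<beta> A) = frame (\<alpha> + \<beta>) A"
proof -
  have "frame \<alpha> (frame \<beta> A)
      = (rotation \<alpha> ** rotation \<beta>) ** A ** (rotation (- \<beta>) ** rotation (- \<alpha>))"
    by (simp add: frame_def matrix_mul_assoc)
  then show ?thesis by (simp add: rotation_add frame_def add.commute)
qed

lemma frame_0: "frame 0 A = A"
  by (simp add: frame_def rotation_0)

lemma inj_frame: "inj (frame \<theta>)"
  by (rule inj_on_inverseI[of _ "frame (- \<theta>)"]) (simp add: frame_add_angle frame_0)

text \<open>
  The two inner rotations cancel, because \<open>R(-\<theta>)\<close> is the inverse of \<open>R(\<theta>)\<close>. This is what makes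
  the matrix equation independent of the choice of frame.
\<close>
lemma frame_mult: "frame \<theta> A ** frame \<theta> B = frame \<theta> (A ** B)"
proof -
  have "frame \<theta> A ** frame \<theta> B
      = rotation \<theta> ** A ** (rotation (- \<theta>) ** rotation \<theta>) ** B ** rotation (- \<theta>)"
    by (simp add: frame_def matrix_mul_assoc)
  then show ?thesis by (simp add: rotation_add rotation_0 frame_def matrix_mul_assoc)
qed

lemma linear_frame: "linear (frame \<theta>)"
  by (rule linearI)
     (simp_all add: frame_def matrix2_simps algebra_simps)

lemma commutator_frame: "commutator (frame \<theta> A) (frame \<theta> B) = frame \<theta> (commutator A B)"
  by (simp add: commutator_def frame_mult linear_diff[OF linear_frame])

text \<open>
  Only relative angles matter: this fact lets all matrices be seen from the eigenframe of a chosen one.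
\<close>
lemma spectral_matrix_frame: "spectral_matrix a b \<phi> = frame \<theta> (spectral_matrix a b (\<phi> - \<theta>))"
proof -
  have "spectral_matrix a b \<psi> = frame \<psi> (diag2 a b)" for \<psi>
    by (simp add: spectral_matrix_def frame_def)
  then show ?thesis by (simp add: frame_add_angle)
qed

lemma spectral_matrix_eq:
  "spectral_matrix a b \<phi> = symmetric2 (a * (cos \<phi>)\<^sup>2 + b * (sin \<phi>)\<^sup>2) ((b - a) * (sin \<phi> * cos \<phi>))
      (a * (sin \<phi>)\<^sup>2 + b * (cos \<phi>)\<^sup>2)"
  by (simp add: spectral_matrix_def symmetric2_def rotation_def diag2_def matrix2_simps algebra_simps power2_eq_square)

lemma sum_symmetric2:
  "(\<Sum>j\<in>J. symmetric2 (f j) (g j) (h j)) = symmetric2 (\<Sum>j\<in>J. f j) (\<Sum>j\<in>J. g j) (\<Sum>j\<in>J. h j)"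
  by (simp add: symmetric2_def matrix2_simps)

lemma symmetric2_inject:
  "symmetric2 a c b = symmetric2 a' c' b' \<longleftrightarrow> a = a' \<and> c = c' \<and> b = b'"
  by (auto simp: symmetric2_def matrix2_simps)

lemma double_commutator_symmetric2_diag:
  "commutator (symmetric2 p r q) (commutator (diag2 a b) (symmetric2 p r q))
    = symmetric2 (2 * (b - a) * r\<^sup>2) ((b - a) * r * (q - p)) (- 2 * (b - a) * r\<^sup>2)"
  by (simp add: commutator_def symmetric2_def diag2_def matrix2_simps algebra_simps power2_eq_square)

text \<open>
  By \<open>spectral_matrix_frame\<close> only \<open>\<theta> = 0\<close> has to be computed. The diagonal entries are opposite,
  and their difference (lower minus upper) is one summand of the right-hand side of the gap equation;
  the off-diagonal entry is the eigenvalue gap \<open>b - a\<close> times one summand of the angle equation.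
\<close>
lemma double_commutator_spectral_matrix:
  fixes a b c d \<theta> \<phi> :: real
  defines "p \<equiv> (d - c)\<^sup>2 * (sin (2 * (\<phi> - \<theta>)))\<^sup>2"
      and "q \<equiv> 1/4 * (d - c)\<^sup>2 * sin (4 * (\<phi> - \<theta>))"
  shows "commutator (spectral_matrix c d \<phi>)
      (commutator (spectral_matrix a b \<theta>) (spectral_matrix c d \<phi>))
    = frame \<theta> (symmetric2 ((b - a) * p / 2) ((b - a) * q) (- ((b - a) * p / 2)))"
proof -
  define \<delta> where "\<delta> = \<phi> - \<theta>"
  have s4: "sin (4 * \<delta>) = 4 * sin \<delta> * cos \<delta> * ((cos \<delta>)\<^sup>2 - (sin \<delta>)\<^sup>2)"
    using sin_double[of "2 * \<delta>"] by (simp add: sin_double cos_double)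
  have "commutator (spectral_matrix c d \<delta>) (commutator (diag2 a b) (spectral_matrix c d \<delta>))
      = symmetric2 ((b - a) * p / 2) ((b - a) * q) (- ((b - a) * p / 2))"
    unfolding spectral_matrix_eq double_commutator_symmetric2_diag symmetric2_inject p_def q_def
      \<delta>_def[symmetric] s4 sin_double
    by (simp add: field_simps power2_eq_square)
  moreover have "spectral_matrix a b \<theta> = frame \<theta> (diag2 a b)"
    by (simp add: spectral_matrix_def frame_def)
  moreover have "spectral_matrix c d \<phi> = frame \<theta> (spectral_matrix c d \<delta>)"
    unfolding \<delta>_def by (rule spectral_matrix_frame)
  ultimately show ?thesis by (simp add: commutator_frame)
qed

lemma has_vector_derivative_symmetric2:
  assumes "(f has_real_derivative f') F" "(g has_real_derivative g') F" "(h has_real_derivative h') F"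
  shows "((\<lambda>t. symmetric2 (f t) (g t) (h t)) has_vector_derivative symmetric2 f' g' h') F"
proof -
  have basis: "symmetric2 x y z
      = x *\<^sub>R symmetric2 1 0 0 + y *\<^sub>R symmetric2 0 1 0 + z *\<^sub>R symmetric2 0 0 1" for x y z
    by (simp add: symmetric2_def matrix2_simps)
  show ?thesis
    unfolding basis[of "f _"] basis[of f']
    using assms unfolding has_real_derivative_iff_has_vector_derivative
    by (intro has_vector_derivative_add
        bounded_linear.has_vector_derivative[OF bounded_linear_scaleR_left])
qed

text \<open>
  The rotation of the frame adds \<open>\<theta>'\<close> times the commutator of the generator of rotations with the
  diagonal matrix of eigenvalues. That commutator is purely off-diagonal and proportional to the
  eigenvalue gap, so it does not mix with the motion of the eigenvalues.
\<close>
lemma has_vector_derivative_spectral_matrix: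
  assumes "(a has_real_derivative a') (at t within T)" "(b has_real_derivative b') (at t within T)"
    "(\<theta> has_real_derivative \<theta>') (at t within T)"
  shows "((\<lambda>t. spectral_matrix (a t) (b t) (\<theta> t)) has_vector_derivative
      frame (\<theta> t) (symmetric2 a' ((b t - a t) * \<theta>') b')) (at t within T)"
proof -
  define c s where cs: "c = cos (\<theta> t)" "s = sin (\<theta> t)"
  have "frame (\<theta> t) (symmetric2 a' ((b t - a t) * \<theta>') b') =
    symmetric2 (a' * c\<^sup>2 + b' * s\<^sup>2 + 2 * (b t - a t) * (s * c) * \<theta>')
      ((b' - a') * (s * c) + (b t - a t) * (c\<^sup>2 - s\<^sup>2) * \<theta>')
      (a' * s\<^sup>2 + b' * c\<^sup>2 - 2 * (b t - a t) * (s * c) * \<theta>')"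
    by (simp add: frame_def symmetric2_def rotation_def matrix2_simps cs algebra_simps power2_eq_square)
  moreover have "((\<lambda>t. spectral_matrix (a t) (b t) (\<theta> t)) has_vector_derivative \<dots>) (at t within T)"
    unfolding spectral_matrix_eq
    by (rule has_vector_derivative_symmetric2; (rule derivative_eq_intros assms refl)+;
        simp add: cs algebra_simps power2_eq_square)
  ultimately show ?thesis by simp
qed

theorem mainTheorem1:
  fixes N :: nat and T :: "real set"
    and M :: "nat \<Rightarrow> real \<Rightarrow> real^2^2"
    and l1 l2 \<theta> :: "nat \<Rightarrow> real \<Rightarrow> real"
  assumes "is_interval T" and "\<exists>a\<in>T. \<exists>b\<in>T. a < b"
    and "\<And>i t. i \<in> {1..N} \<Longrightarrow> t \<in> T \<Longrightarrow> transpose (M i t) = M i t"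
    and "\<And>i t. i \<in> {1..N} \<Longrightarrow> t \<in> T \<Longrightarrow> M i t = spectral_matrix (l1 i t) (l2 i t) (\<theta> i t)"
    and "\<And>i. i \<in> {1..N} \<Longrightarrow> l1 i differentiable_on T"
    and "\<And>i. i \<in> {1..N} \<Longrightarrow> l2 i differentiable_on T"
    and "\<And>i. i \<in> {1..N} \<Longrightarrow> \<theta> i differentiable_on T"
  shows "((\<forall>i\<in>{1..N}. \<forall>t\<in>T. l1 i t \<noteq> l2 i t) \<longrightarrow>
            (matrix_flow N T M \<longleftrightarrow> spectral_flow N T l1 l2 \<theta>))
       \<and> (spectral_flow N T l1 l2 \<theta> \<longrightarrow> matrix_flow N T M)
       \<and> (matrix_flow N T M \<longleftrightarrow> spectral_flow_where_distinct N T l1 l2 \<theta>)"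
proof -
  \<comment> \<open>Derivatives within \<open>T\<close> are unique because a nondegenerate interval has no isolated points.\<close>
  have nontrivial: "at t within T \<noteq> bot" if "t \<in> T" for t
  proof -
    have "T \<noteq> {x}" for x
      using assms(2) by auto
    then have "t islimpt T"
      using connected_imp_perfect is_interval_connected[OF assms(1)] that by blast
    then show ?thesis
      by (simp add: trivial_limit_within)
  qed
  have pointwise: "(M i has_vector_derivative
        (\<Sum>j=1..N. commutator (M j t) (commutator (M i t) (M j t)))) (at t within T)
      \<longleftrightarrow> trace_eqn T l1 l2 i t \<and> gap_eqn N T l1 l2 \<theta> i t \<and>
        (l1 i t \<noteq> l2 i t \<longrightarrow> angle_eqn N T l1 l2 \<theta> i t)"
    if i: "i \<in> {1..N}" and t: "t \<in> T" for i t
  proof -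
    define a' b' \<theta>' where derivs:
      "a' = vector_derivative (l1 i) (at t within T)"
      "b' = vector_derivative (l2 i) (at t within T)"
      "\<theta>' = vector_derivative (\<theta> i) (at t within T)"
    define d where "d = l2 i t - l1 i t"
    have gap: "d = 0 \<longleftrightarrow> l1 i t = l2 i t"
      by (auto simp: d_def)
    define P where "P = (\<Sum>j=1..N. (l2 j t - l1 j t)\<^sup>2 * (sin (2 * (\<theta> j t - \<theta> i t)))\<^sup>2)"
    define Q where "Q = (\<Sum>j=1..N. 1/4 * (l2 j t - l1 j t)\<^sup>2 * sin (4 * (\<theta> j t - \<theta> i t)))"
    have real_deriv: "(f has_real_derivative vector_derivative f (at t within T)) (at t within T)"
      if "f differentiable_on T" for f :: "real \<Rightarrow> real"
      using that t
      by (simp add: differentiable_on_def vector_derivative_works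
          has_real_derivative_iff_has_vector_derivative)
    have "((\<lambda>t. spectral_matrix (l1 i t) (l2 i t) (\<theta> i t)) has_vector_derivative
        frame (\<theta> i t) (symmetric2 a' (d * \<theta>') b')) (at t within T)"
      unfolding d_def derivs using i assms(5-7)
      by (intro has_vector_derivative_spectral_matrix real_deriv) auto
    then have lhs: "(M i has_vector_derivative
        frame (\<theta> i t) (symmetric2 a' (d * \<theta>') b')) (at t within T)"
      using i t assms(4) by (intro has_vector_derivative_transform[of t T "M i"]) auto
    have "(\<Sum>j=1..N. commutator (M j t) (commutator (M i t) (M j t)))
        = (\<Sum>j=1..N. frame (\<theta> i t) (symmetric2
            (d * ((l2 j t - l1 j t)\<^sup>2 * (sin (2 * (\<theta> j t - \<theta> i t)))\<^sup>2) / 2)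
            (d * (1/4 * (l2 j t - l1 j t)\<^sup>2 * sin (4 * (\<theta> j t - \<theta> i t))))
            (- (d * ((l2 j t - l1 j t)\<^sup>2 * (sin (2 * (\<theta> j t - \<theta> i t)))\<^sup>2) / 2))))"
      using i t by (intro sum.cong refl) (simp only: assms(4) double_commutator_spectral_matrix d_def)
    also have "\<dots> = frame (\<theta> i t) (symmetric2 (d * P / 2) (d * Q) (- (d * P / 2)))"
      by (simp only: linear_sum[OF linear_frame, symmetric] sum_symmetric2 P_def Q_def
          sum_distrib_left sum_divide_distrib sum_negf)
    finally have rhs: "(\<Sum>j=1..N. commutator (M j t) (commutator (M i t) (M j t)))
        = frame (\<theta> i t) (symmetric2 (d * P / 2) (d * Q) (- (d * P / 2)))" .
    have "(M i has_vector_derivative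
          (\<Sum>j=1..N. commutator (M j t) (commutator (M i t) (M j t)))) (at t within T)
        \<longleftrightarrow> frame (\<theta> i t) (symmetric2 a' (d * \<theta>') b')
          = frame (\<theta> i t) (symmetric2 (d * P / 2) (d * Q) (- (d * P / 2)))"
      unfolding rhs using lhs vector_derivative_unique_within[OF nontrivial[OF t] lhs] by metis
    also have "\<dots> \<longleftrightarrow> a' = d * P / 2 \<and> d * \<theta>' = d * Q \<and> b' = - (d * P / 2)"
      by (simp add: inj_eq[OF inj_frame] symmetric2_inject)
    also have "\<dots> \<longleftrightarrow> a' + b' = 0 \<and> b' - a' = - d * P \<and> (l1 i t \<noteq> l2 i t \<longrightarrow> \<theta>' = Q)"
      using gap by auto
    finally show ?thesis
      unfolding trace_eqn_def gap_eqn_def angle_eqn_def derivs[symmetric] P_def Q_def d_def .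
  qed
  have "matrix_flow N T M \<longleftrightarrow> spectral_flow_where_distinct N T l1 l2 \<theta>"
    unfolding matrix_flow_def spectral_flow_where_distinct_def by (intro ball_cong refl pointwise)
  then show ?thesis
    by (auto simp: spectral_flow_def spectral_flow_where_distinct_def)
qed

end
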